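(* Let $m,n\ge 1$ and let $a_1,\ldots,a_m,b_1,\ldots,b_m,c_1,\ldots,c_n,d_1,\ldots,d_n$ be nonnegative integers with $a_i\le b_i$ for $1\le i\le m$, $c_j\le d_j$ for $1\le j\le n$, $b_1\ge \cdots\ge b_m$, $d_1\ge \cdots\ge d_n$, $\sum_{i=1}^n d_i=\sum_{i=1}^m a_i$ and $\sum_{i=1}^n c_i=\sum_{i=1}^m b_i$. Then $(L_1;L_2)$, where $L_1=([a_1,b_1],\ldots,[a_m,b_m])$ and $L_2=([c_1,d_1],\ldots,[c_n,d_n])$, is forcibly bigraphic if and only if $$\sum_{i=1}^k b_i\le \sum_{i=1}^n \min\{c_i,k\}\quad\text{for each } k \text{ with } 1\le k\le m$$ and $$\sum_{i=1}^k d_i\le \sum_{i=1}^m \min\{a_i,k\}\quad\text{for each } k \text{ with } 1\le k\le n.$$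
   Context: All graphs are finite, undirected, without loops or parallel edges. A pair $(P;Q)$ of sequences $P=(p_1,\ldots,p_m)$, $Q=(q_1,\ldots,q_n)$ of nonnegative integers is called bigraphic if there is a bipartite graph $G$ with partite sets $X=\{x_1,\ldots,x_m\}$ and $Y=\{y_1,\ldots,y_n\}$ such that $d_G(x_i)=p_i$ for $1\le i\le m$ and $d_G(y_j)=q_j$ for $1\le j\le n$. The pair of interval sequences $(L_1;L_2)$ is called forcibly bigraphic if every pair $(P;Q)$ with $P=(p_1,\ldots,p_m)$, $Q=(q_1,\ldots,q_n)$ of integers satisfying $a_i\le p_i\le b_i$ for $1\le i\le m$, $c_j\le q_j\le d_j$ for $1\le j\le n$, and $\sum_{i=1}^m p_i=\sum_{j=1}^n q_j$ is bigraphic. *)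

theory Defs
  imports Complex_Main "Graph_Theory.Graph_Theory"
begin

text \<open>
  Sequences of length \<open>m\<close> are functions on \<open>nat\<close> of which only the values at
  \<open>1, \<dots>, m\<close> matter. Finite simple graphs are the library's \<open>pair_graph\<close>s, that is,
  finite loopless symmetric digraphs without parallel arcs: an edge \<open>{u, v}\<close> is the pair of
  arcs \<open>(u, v)\<close> and \<open>(v, u)\<close>.
\<close>

definition bipartite_graph :: "'v pair_pre_digraph \<Rightarrow> 'v set \<Rightarrow> 'v set \<Rightarrow> bool" where
  "bipartite_graph G X Y \<longleftrightarrow>
     pair_graph G \<and> pverts G = X \<union> Y \<and> X \<inter> Y = {} \<and> parcs G \<subseteq> X \<times> Y \<union> Y \<times> X"

text \<open>
  In a symmetric digraph each edge at \<open>v\<close> contributes exactly one arc leaving \<open>v\<close>, so the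
  out-degree is the degree of the undirected graph.
\<close>

definition degree_in :: "'v pair_pre_digraph \<Rightarrow> 'v \<Rightarrow> nat" where
  "degree_in G v = out_degree (with_proj G) v"

text \<open>
  Taking the vertices from \<open>nat\<close> is no restriction, since every finite graph is isomorphic to
  one on a set of natural numbers.
\<close>

definition bigraphic :: "nat \<Rightarrow> nat \<Rightarrow> (nat \<Rightarrow> nat) \<Rightarrow> (nat \<Rightarrow> nat) \<Rightarrow> bool" where
  "bigraphic m n p q \<longleftrightarrow>
     (\<exists>(G :: nat pair_pre_digraph) x y.
        inj_on x {1..m} \<and> inj_on y {1..n} \<and>
        bipartite_graph G (x ` {1..m}) (y ` {1..n}) \<and>
        (\<forall>i\<in>{1..m}. degree_in G (x i) = p i) \<and>
        (\<forall>j\<in>{1..n}. degree_in G (y j) = q j))"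

text \<open>
  Here \<open>L1 i\<close> is the set of values allowed at position \<open>i\<close>; the interval sequence
  \<open>([a\<^sub>1, b\<^sub>1], \<dots>, [a\<^sub>m, b\<^sub>m])\<close> is \<open>\<lambda>i. {a i..b i}\<close>.
\<close>

definition forcibly_bigraphic ::
  "nat \<Rightarrow> nat \<Rightarrow> (nat \<Rightarrow> nat set) \<Rightarrow> (nat \<Rightarrow> nat set) \<Rightarrow> bool" where
  "forcibly_bigraphic m n L1 L2 \<longleftrightarrow>
     (\<forall>p q. (\<forall>i\<in>{1..m}. p i \<in> L1 i) \<and> (\<forall>j\<in>{1..n}. q j \<in> L2 j) \<and>
            (\<Sum>i=1..m. p i) = (\<Sum>j=1..n. q j)
        \<longrightarrow> bigraphic m n p q)"

end

theory Submission
  imports Defs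
begin

text \<open>
  Summing the hypotheses gives \<open>\<Sum>a \<le> \<Sum>b = \<Sum>c \<le> \<Sum>d = \<Sum>a\<close>, so both families of intervals are
  degenerate and the claim is the Gale--Ryser theorem for \<open>(b; d)\<close>. Necessity is a count of the
  edges at the first \<open>k\<close> vertices. For sufficiency, start from the relation in which row \<open>i\<close>
  occupies the first \<open>a i\<close> columns: its column sums dominate \<open>d\<close>. As long as some column falls
  short of \<open>d\<close>, take the first such column \<open>l\<close>; some earlier column \<open>j\<close> is in excess, and one
  entry can be moved from \<open>j\<close> to \<open>l\<close> inside a row without losing domination.
\<close>

section \<open>Relations with prescribed row and column sums\<close>

text \<open>\<open>R\<close> is the biadjacency matrix of a bipartite graph. Arguing with matrices
  confines arcs and vertex names to the two translation lemmas.\<close>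

definition has_degrees ::
  "'a set \<Rightarrow> 'b set \<Rightarrow> ('a \<Rightarrow> 'b \<Rightarrow> bool) \<Rightarrow> ('a \<Rightarrow> nat) \<Rightarrow> ('b \<Rightarrow> nat) \<Rightarrow> bool" where
  "has_degrees X Y R p q \<longleftrightarrow>
     (\<forall>i\<in>X. card {j\<in>Y. R i j} = p i) \<and> (\<forall>j\<in>Y. card {i\<in>X. R i j} = q j)"

lemma has_degrees_conversep:
  "has_degrees X Y R p q \<Longrightarrow> has_degrees Y X (\<lambda>j i. R i j) q p"
  by (auto simp: has_degrees_def)

lemma has_degrees_sum_eq:
  assumes "finite X" "finite Y" "has_degrees X Y R p q"
  shows "sum p X = sum q Y"
proof -
  have "sum p X = (\<Sum>i\<in>X. card {j\<in>Y. R i j})"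
    using assms by (auto simp: has_degrees_def)
  also have "\<dots> = (\<Sum>j\<in>Y. card {i\<in>X. R i j})"
    using assms by (intro sum_multicount_gen) auto
  also have "\<dots> = sum q Y"
    using assms by (auto simp: has_degrees_def)
  finally show ?thesis .
qed

text \<open>Restrict the relation to the rows in \<open>A\<close> and count its entries by
  columns.\<close>

lemma has_degrees_sum_le:
  assumes "finite X" "finite Y" "has_degrees X Y R p q" "A \<subseteq> X"
  shows "sum p A \<le> (\<Sum>j\<in>Y. min (q j) (card A))"
proof -
  have fin: "finite A" using assms finite_subset by blast
  have "has_degrees A Y R p (\<lambda>j. card {i\<in>A. R i j})"
    using assms by (auto simp: has_degrees_def)
  then have "sum p A = (\<Sum>j\<in>Y. card {i\<in>A. R i j})"
    using has_degrees_sum_eq fin assms(2) by blast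
  also have "\<dots> \<le> (\<Sum>j\<in>Y. min (q j) (card A))"
  proof (intro sum_mono min.boundedI)
    fix j assume j: "j \<in> Y"
    have "card {i\<in>A. R i j} \<le> card {i\<in>X. R i j}"
      using assms by (intro card_mono) auto
    then show "card {i\<in>A. R i j} \<le> q j"
      using assms(3) j by (auto simp: has_degrees_def)
    show "card {i\<in>A. R i j} \<le> card A"
      using fin by (intro card_mono) auto
  qed
  finally show ?thesis .
qed

text \<open>The longer column \<open>j\<close> cannot be contained in column \<open>l\<close>, so
  some row meets \<open>j\<close> but not \<open>l\<close>. Moving that entry keeps the row
  sum.\<close>

lemma has_degrees_transfer:
  assumes fin: "finite X" "finite Y" and R: "has_degrees X Y R p r"
    and j: "j \<in> Y" and l: "l \<in> Y" and less: "r l < r j"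
  obtains R' where "has_degrees X Y R' p (r(j := r j - 1, l := Suc (r l)))"
proof -
  have "\<not> {i\<in>X. R i j} \<subseteq> {i\<in>X. R i l}"
  proof
    assume "{i\<in>X. R i j} \<subseteq> {i\<in>X. R i l}"
    then have "card {i\<in>X. R i j} \<le> card {i\<in>X. R i l}"
      using fin by (intro card_mono) auto
    then show False using R j l less by (auto simp: has_degrees_def)
  qed
  then obtain i where i: "i \<in> X" "R i j" "\<not> R i l" by blast
  then have jl: "j \<noteq> l" by auto
  define R' where "R' = R(i := (R i)(j := False, l := True))"
  have row: "card {y\<in>Y. R' x y} = p x" if "x \<in> X" for x
  proof (cases "x = i")
    case True
    have "{y\<in>Y. R' x y} = insert l ({y\<in>Y. R i y} - {j})"
      using True i j l by (auto simp: R'_def)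
    moreover have "card \<dots> = card {y\<in>Y. R i y}"
      using i j fin by (subst card_insert_disjoint) (auto simp: card_Suc_Diff1 simp del: card_Diff_insert)
    ultimately show ?thesis using R True i by (auto simp: has_degrees_def)
  next
    case False
    then show ?thesis using R that by (auto simp: has_degrees_def R'_def)
  qed
  have "{x\<in>X. R' x j} = {x\<in>X. R x j} - {i}" using jl by (auto simp: R'_def)
  then have colj: "card {x\<in>X. R' x j} = r j - 1"
    using i j fin R by (auto simp: has_degrees_def)
  have "{x\<in>X. R' x l} = insert i {x\<in>X. R x l}" using i by (auto simp: R'_def)
  then have coll: "card {x\<in>X. R' x l} = Suc (r l)"
    using i l fin R by (auto simp: has_degrees_def)
  have "card {x\<in>X. R' x y} = r y" if "y \<in> Y" "y \<noteq> j" "y \<noteq> l" for y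
  proof -
    have "{x\<in>X. R' x y} = {x\<in>X. R x y}" using that by (auto simp: R'_def)
    then show ?thesis using R that by (auto simp: has_degrees_def)
  qed
  then have "has_degrees X Y R' p (r(j := r j - 1, l := Suc (r l)))"
    using row colj coll jl by (auto simp: has_degrees_def)
  then show thesis by (rule that)
qed

text \<open>Positivity of \<open>r j\<close> makes the truncated subtraction exact, so loss and gain
  cancel.\<close>

lemma sum_transfer:
  fixes r :: "'b \<Rightarrow> nat"
  assumes "finite A" "j \<in> A" "l \<in> A" "j \<noteq> l" "0 < r j"
  shows "sum (r(j := r j - 1, l := Suc (r l))) A = sum r A"
proof -
  let ?r = "r(j := r j - 1, l := Suc (r l))"
  have split: "sum f A = f j + (f l + sum f (A - {j} - {l}))" for f :: "'b \<Rightarrow> nat"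
    using assms by (simp add: sum.remove[of A j] sum.remove[of "A - {j}" l])
  have "sum ?r (A - {j} - {l}) = sum r (A - {j} - {l})"
    by (intro sum.cong) auto
  then show ?thesis
    using assms unfolding split[of ?r] split[of r] by simp
qed

text \<open>Induction on the total deficit. Truncated subtraction counts only the columns that fall
  short of \<open>q\<close>.\<close>

lemma has_degrees_dominated:
  fixes q r :: "nat \<Rightarrow> nat"
  assumes "finite X" "has_degrees X {1..n} R p r" "antimono_on {1..n} q"
    and "sum q {1..n} = sum r {1..n}"
    and "\<And>k. k \<in> {1..n} \<Longrightarrow> sum q {1..k} \<le> sum r {1..k}"
  obtains R' where "has_degrees X {1..n} R' p q"
  using assms
proof (induction "\<Sum>j=1..n. q j - r j" arbitrary: R r thesis rule: less_induct)
  case less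
  show ?case
  proof (cases "\<exists>l\<in>{1..n}. r l < q l")
    case False
    \<comment> \<open>No column falls short, so a single strict excess would separate the equal
      totals.\<close>
    have "q j = r j" if "j \<in> {1..n}" for j
    proof (rule ccontr)
      assume "q j \<noteq> r j"
      with that False have "sum q {1..n} < sum r {1..n}"
        by (intro sum_strict_mono_ex1) (auto simp: not_less intro!: bexI[of _ j] le_neq_implies_less)
      with less.prems show False by simp
    qed
    then have "has_degrees X {1..n} R p q"
      using less.prems by (auto simp: has_degrees_def)
    then show ?thesis by (rule less.prems(1))
  next
    case True
    define l where "l = (LEAST l. l \<in> {1..n} \<and> r l < q l)"
    have "l \<in> {1..n} \<and> r l < q l"
      unfolding l_def by (rule LeastI_ex) (use True in blast)
    then have l: "l \<in> {1..n}" "r l < q l" by blast+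
    have below: "q k \<le> r k" if "k \<in> {1..<l}" for k
      using that l not_less_Least[of k "\<lambda>l. l \<in> {1..n} \<and> r l < q l"]
      unfolding l_def[symmetric] by auto
    \<comment> \<open>Without an earlier excess, the shortfall at \<open>l\<close> would violate
      domination of the prefix ending at \<open>l\<close>.\<close>
    have "\<exists>j\<in>{1..<l}. q j < r j"
    proof (rule ccontr)
      assume "\<not> (\<exists>j\<in>{1..<l}. q j < r j)"
      then have "sum r {1..<l} \<le> sum q {1..<l}"
        by (intro sum_mono) (auto simp: not_less)
      moreover have "sum f {1..l} = sum f {1..<l} + f l" for f :: "nat \<Rightarrow> nat"
        using l by (subst atLeastLessThanSuc_atLeastAtMost[symmetric]) auto
      ultimately have "sum r {1..l} < sum q {1..l}" using l by simp
      with less.prems(6)[OF l(1)] show False by simp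
    qed
    then obtain j where j: "j \<in> {1..<l}" "q j < r j" by blast
    have jY: "j \<in> {1..n}" using j l by auto
    \<comment> \<open>The chain \<open>r l < q l \<le> q j < r j\<close> gives the length condition
      for the transfer.\<close>
    have "q l \<le> q j"
      using less.prems(4) jY l(1) j by (auto simp: monotone_on_def)
    with j l have lt: "r l < r j" by simp
    let ?r = "r(j := r j - 1, l := Suc (r l))"
    obtain R' where R': "has_degrees X {1..n} R' p ?r"
      using has_degrees_transfer[OF less.prems(2) _ less.prems(3) jY l(1) lt] by blast
    show ?thesis
    proof (rule less.hyps[OF _ less.prems(1,2) R' less.prems(4)])
      \<comment> \<open>The deficit at \<open>l\<close> drops by one; \<open>j\<close> was strictly
        in excess, so it still contributes zero.\<close>
      show "(\<Sum>j=1..n. q j - ?r j) < (\<Sum>j=1..n. q j - r j)"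
        using l j by (intro sum_strict_mono_ex1) (auto intro!: bexI[of _ l])
      show "sum q {1..n} = sum ?r {1..n}"
        using less.prems(5) jY l j by (subst sum_transfer) auto
      fix k assume k: "k \<in> {1..n}"
      show "sum q {1..k} \<le> sum ?r {1..k}"
      \<comment> \<open>A prefix ending before \<open>l\<close> stays dominated term by term; any
        other contains both \<open>j\<close> and \<open>l\<close> and keeps its sum.\<close>
      proof (cases "k < l")
        case True
        show ?thesis
        proof (intro sum_mono)
          fix i assume "i \<in> {1..k}"
          then show "q i \<le> ?r i" using True below[of i] j by auto
        qed
      next
        case False
        then have "sum ?r {1..k} = sum r {1..k}"
          using j l by (intro sum_transfer) auto
        with less.prems(6)[OF k] show ?thesis by simp
      qed
    qed
  qed
qed

section \<open>Sufficiency in the Gale--Ryser theorem\<close>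

lemma gale_ryser_sufficient:
  fixes p :: "'a \<Rightarrow> nat" and q :: "nat \<Rightarrow> nat"
  assumes fin: "finite X" and "n \<ge> 1" and anti: "antimono_on {1..n} q"
    and sums: "sum p X = sum q {1..n}"
    and dom: "\<And>k. k \<in> {1..n} \<Longrightarrow> sum q {1..k} \<le> (\<Sum>i\<in>X. min (p i) k)"
  obtains R where "has_degrees X {1..n} R p q"
proof -
  \<comment> \<open>The hypothesis at \<open>k = n\<close> together with equal totals leaves no room
    for a row longer than \<open>n\<close>.\<close>
  have pn: "p i \<le> n" if "i \<in> X" for i
  proof (rule ccontr)
    assume "\<not> p i \<le> n"
    then have "(\<Sum>i\<in>X. min (p i) n) < sum p X"
      using that fin by (intro sum_strict_mono_ex1) (auto intro!: bexI[of _ i])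
    with dom[of n] sums \<open>n \<ge> 1\<close> show False by simp
  qed
  \<comment> \<open>This is the Ferrers diagram of \<open>p\<close>, and \<open>?r\<close> is the
    conjugate sequence. Counting its first \<open>k\<close> columns by rows turns \<open>dom\<close>
    into domination by \<open>?r\<close>.\<close>
  let ?R = "\<lambda>i j. j \<le> p i" and ?r = "\<lambda>j. card {i\<in>X. j \<le> p i}"
  have part: "has_degrees X {1..k} ?R (\<lambda>i. min (p i) k) ?r" for k
  proof -
    have "{j\<in>{1..k}. j \<le> p i} = {1..min (p i) k}" for i by auto
    then show ?thesis by (auto simp: has_degrees_def)
  qed
  have R: "has_degrees X {1..n} ?R p ?r"
    using part[of n] pn by (auto simp: has_degrees_def min_absorb1)
  have "sum q {1..k} \<le> sum ?r {1..k}" if "k \<in> {1..n}" for k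
    using dom[OF that] has_degrees_sum_eq[OF fin _ part[of k]] by simp
  moreover have "sum q {1..n} = sum ?r {1..n}"
    using has_degrees_sum_eq[OF fin _ R] sums by simp
  ultimately show thesis
    using has_degrees_dominated[OF fin R anti] that by blast
qed

section \<open>Translation between bipartite graphs and relations\<close>

lemma bigraphic_imp_has_degrees:
  assumes "bigraphic m n p q"
  obtains R where "has_degrees {1..m} {1..n} R p q"
proof -
  obtain G :: "nat pair_pre_digraph" and x y where
    inj: "inj_on x {1..m}" "inj_on y {1..n}" and
    bip: "bipartite_graph G (x ` {1..m}) (y ` {1..n})" and
    deg: "\<And>i. i \<in> {1..m} \<Longrightarrow> degree_in G (x i) = p i"
      "\<And>j. j \<in> {1..n} \<Longrightarrow> degree_in G (y j) = q j"
    using assms unfolding bigraphic_def by blast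
  interpret pair_graph G using bip by (simp add: bipartite_graph_def)
  have disj: "x i \<noteq> y j" if "i \<in> {1..m}" "j \<in> {1..n}" for i j
    using bip that unfolding bipartite_graph_def by blast
  have arcs: "parcs G \<subseteq> x ` {1..m} \<times> y ` {1..n} \<union> y ` {1..n} \<times> x ` {1..m}"
    using bip by (simp add: bipartite_graph_def)
  have sym: "(v, u) \<in> parcs G" if "(u, v) \<in> parcs G" for u v
    using that arcs_symmetric by simp
  let ?R = "\<lambda>i j. (x i, y j) \<in> parcs G"
  have "card {j\<in>{1..n}. ?R i j} = p i" if i: "i \<in> {1..m}" for i
  proof -
    \<comment> \<open>As the classes are disjoint, every arc leaving \<open>x i\<close> ends in the
      other class.\<close>
    have "out_arcs (with_proj G) (x i) = (\<lambda>j. (x i, y j)) ` {j\<in>{1..n}. ?R i j}"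
      using arcs disj[OF i] by (force simp: out_arcs_def)
    moreover have "inj_on (\<lambda>j. (x i, y j)) {j\<in>{1..n}. ?R i j}"
      by (intro inj_onI) (auto dest: inj_onD[OF inj(2)])
    ultimately show ?thesis
      using deg(1)[OF i] by (simp add: degree_in_def out_degree_def card_image)
  qed
  moreover have "card {i\<in>{1..m}. ?R i j} = q j" if j: "j \<in> {1..n}" for j
  proof -
    \<comment> \<open>\<open>?R\<close> records arcs from the \<open>x\<close> side only; symmetry
      reverses them.\<close>
    have "out_arcs (with_proj G) (y j) = (\<lambda>i. (y j, x i)) ` {i\<in>{1..m}. ?R i j}"
      using arcs disj[OF _ j] sym by (force simp: out_arcs_def)
    moreover have "inj_on (\<lambda>i. (y j, x i)) {i\<in>{1..m}. ?R i j}"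
      by (intro inj_onI) (auto dest: inj_onD[OF inj(1)])
    ultimately show ?thesis
      using deg(2)[OF j] by (simp add: degree_in_def out_degree_def card_image)
  qed
  ultimately have "has_degrees {1..m} {1..n} ?R p q"
    by (auto simp: has_degrees_def)
  then show thesis by (rule that)
qed

lemma has_degrees_imp_bigraphic:
  assumes R: "has_degrees {1..m} {1..n} R p q"
  shows "bigraphic m n p q"
proof -
  \<comment> \<open>The shift by \<open>m\<close> makes the second class disjoint from
    \<open>{1..m}\<close>.\<close>
  let ?y = "\<lambda>j. m + j"
  let ?X = "{1..m}" and ?Y = "?y ` {1..n}"
  define E where "E = {(i, m + j) | i j. i \<in> {1..m} \<and> j \<in> {1..n} \<and> R i j}"
  define G where "G = \<lparr>pverts = ?X \<union> ?Y, parcs = E \<union> E\<inverse>\<rparr>"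
  have E: "E \<subseteq> ?X \<times> ?Y" by (auto simp: E_def)
  have "pair_graph G"
  proof
    show "finite (parcs G)"
      using finite_subset[OF E] by (simp add: G_def)
    show "symmetric (with_proj G)"
      by (auto simp: G_def symmetric_def arcs_ends_def arc_to_ends_def sym_def)
  qed (use E in \<open>auto simp: G_def E_def\<close>)
  then have bip: "bipartite_graph G (id ` ?X) ?Y"
    using E by (auto simp: bipartite_graph_def G_def)
  have "degree_in G i = p i" if i: "i \<in> {1..m}" for i
  proof -
    have "out_arcs (with_proj G) i = (\<lambda>j. (i, m + j)) ` {j\<in>{1..n}. R i j}"
      using i by (auto simp: out_arcs_def G_def E_def)
    moreover have "card \<dots> = card {j\<in>{1..n}. R i j}"
      by (intro card_image) (auto simp: inj_on_def)
    ultimately show ?thesis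
      using R i by (simp add: degree_in_def out_degree_def has_degrees_def)
  qed
  moreover have "degree_in G (?y j) = q j" if j: "j \<in> {1..n}" for j
  proof -
    have "out_arcs (with_proj G) (m + j) = (\<lambda>i. (m + j, i)) ` {i\<in>{1..m}. R i j}"
      using j by (auto simp: out_arcs_def G_def E_def)
    moreover have "card \<dots> = card {i\<in>{1..m}. R i j}"
      by (intro card_image) (auto simp: inj_on_def)
    ultimately show ?thesis
      using R j by (simp add: degree_in_def out_degree_def has_degrees_def)
  qed
  ultimately show ?thesis
    unfolding bigraphic_def using bip
    by (intro exI[of _ G] exI[of _ id] exI[of _ ?y]) auto
qed

section \<open>The interval sequences\<close>

theorem theorem1p6:
  fixes m n :: nat and a b c d :: "nat \<Rightarrow> nat"
  assumes "m \<ge> 1" and "n \<ge> 1"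
    and "\<forall>i\<in>{1..m}. a i \<le> b i"
    and "\<forall>j\<in>{1..n}. c j \<le> d j"
    and "antimono_on {1..m} b"
    and "antimono_on {1..n} d"
    and "(\<Sum>i=1..n. d i) = (\<Sum>i=1..m. a i)"
    and "(\<Sum>i=1..n. c i) = (\<Sum>i=1..m. b i)"
  shows "forcibly_bigraphic m n (\<lambda>i. {a i..b i}) (\<lambda>j. {c j..d j}) \<longleftrightarrow>
           (\<forall>k\<in>{1..m}. (\<Sum>i=1..k. b i) \<le> (\<Sum>i=1..n. min (c i) k)) \<and>
           (\<forall>k\<in>{1..n}. (\<Sum>i=1..k. d i) \<le> (\<Sum>i=1..m. min (a i) k))"
    (is "?F \<longleftrightarrow> ?B \<and> ?D")
proof -
  have "sum a {1..m} \<le> sum b {1..m}" "sum c {1..n} \<le> sum d {1..n}"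
    using assms(3,4) by (auto intro: sum_mono)
  then have sums: "sum a {1..m} = sum b {1..m}" "sum c {1..n} = sum d {1..n}"
    using assms by linarith+
  have ab: "a i = b i" if "i \<in> {1..m}" for i
    using sum_mono_inv[OF sums(1) _ that] assms(3) by auto
  have cd: "c j = d j" if "j \<in> {1..n}" for j
    using sum_mono_inv[OF sums(2) _ that] assms(4) by auto
  show ?thesis
  proof
    assume ?F
    \<comment> \<open>The lower endpoints are an admissible choice: their totals agree, since
      \<open>sum a = sum b = sum c\<close>.\<close>
    then have "bigraphic m n a c"
      unfolding forcibly_bigraphic_def using assms sums by auto
    then obtain R where R: "has_degrees {1..m} {1..n} R a c"
      by (rule bigraphic_imp_has_degrees)
    have ?B
    proof
      fix k assume k: "k \<in> {1..m}"
      have "sum b {1..k} = sum a {1..k}" using k ab by (intro sum.cong) auto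
      also have "\<dots> \<le> (\<Sum>j=1..n. min (c j) k)"
        using has_degrees_sum_le[OF _ _ R, of "{1..k}"] k by simp
      finally show "sum b {1..k} \<le> (\<Sum>j=1..n. min (c j) k)" .
    qed
    moreover have ?D
    proof
      fix k assume k: "k \<in> {1..n}"
      have "sum d {1..k} = sum c {1..k}" using k cd by (intro sum.cong) auto
      also have "\<dots> \<le> (\<Sum>i=1..m. min (a i) k)"
        \<comment> \<open>The same count with rows and columns exchanged.\<close>
        using has_degrees_sum_le[OF _ _ has_degrees_conversep[OF R], of "{1..k}"] k by simp
      finally show "sum d {1..k} \<le> (\<Sum>i=1..m. min (a i) k)" .
    qed
    ultimately show "?B \<and> ?D" ..
  next
    assume "?B \<and> ?D"
    \<comment> \<open>\<open>?D\<close> is the domination condition for row sums \<open>a\<close>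
      and column sums \<open>d\<close>.\<close>
    then obtain R where R: "has_degrees {1..m} {1..n} R a d"
      using gale_ryser_sufficient[of "{1..m}" n d a] assms by auto
    show ?F
      unfolding forcibly_bigraphic_def
    proof (intro allI impI, elim conjE)
      fix p q assume "\<forall>i\<in>{1..m}. p i \<in> {a i..b i}" "\<forall>j\<in>{1..n}. q j \<in> {c j..d j}"
      \<comment> \<open>Each interval is a single point, so \<open>p = a\<close> and
        \<open>q = d\<close> on the index ranges.\<close>
      then have "has_degrees {1..m} {1..n} R p q"
        using R ab cd by (simp add: has_degrees_def)
      then show "bigraphic m n p q" by (rule has_degrees_imp_bigraphic)
    qed
  qed
qed

end
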